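(* There is no functional $\Lambda$ satisfying $\textsf{WFF}(\Lambda)$ which is computable in $\exists^2$; more generally, for any type two functional $\varphi:\mathbb{N}^{\mathbb{N}}\to\mathbb{N}$ there is no functional $\Lambda$ satisfying $\textsf{WFF}(\Lambda)$ which is computable in $\varphi$.
   Context: The metatheory is $\textsf{ZFC}$ and functionals live in the full (set-theoretic) type structure over $\mathbb{N}$. "Computable" (in given functionals) means Kleene computable via the schemes S1–S9. For $f\in\mathbb{N}^{\mathbb{N}}$, $\overline{f}N=\langle f(0),\dots,f(N-1)\rangle$; for a finite sequence $\sigma$, $[\sigma]$ is the set of $f\in2^{\mathbb{N}}$ extending $\sigma$. $\mathbf{m}$ is the usual coin-toss measure on $2^{\mathbb{N}}$. A functional $\Lambda$ of type $(2\times0)\to1^*$ assigns to every $G:\mathbb{N}^{\mathbb{N}}\to\mathbb{N}$ and $k\in\mathbb{N}$ a finite sequence $\Lambda(G,k)$ of elements of $\mathbb{N}^{\mathbb{N}}$. $\textsf{WFF}(\Lambda)$ ("$\Lambda$ is a weak fan functional") is the statement: for all $G:\mathbb{N}^{\mathbb{N}}\to\mathbb{N}$ and $k\in\mathbb{N}$, $\mathbf{m}\big(\bigcup_{g\in\Lambda(G,k)}[\overline{g}G(g)]\big)\geq1-\frac{1}{2^k}$. That such a $\Lambda$ is computable means that the (suitably coded) map giving the length of $\Lambda(G,k)$ and the values $\Lambda(G,k)(i)(n)$ is computable. $\exists^2:\mathbb{N}^{\mathbb{N}}\to\{0,1\}$ is the functional with $\exists^2(f)=0$ if and only if $(\exists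 n)(f(n)=0)$. *)

theory Defs
  imports "HOL-Probability.Probability" "HOL-Library.Nat_Bijection"
begin

type_synonym baire = "nat \<Rightarrow> nat"
type_synonym type2 = "(nat \<Rightarrow> nat) \<Rightarrow> nat"

section \<open>Kleene computability\<close>

text \<open>
  \<open>kleene e ns fs Fs v\<close> says that \<open>{e}(ns, fs, Fs)\<close> is defined with value \<open>v\<close>, by Kleene's schemes
  S1--S9 for arguments of types 0, 1 and 2.  The arguments are kept in one list for each type, as in
  Kleene's original presentation, where the relative order of arguments of different types is
  immaterial and S6 moves the argument number \<open>k\<close> (from 0) of type \<open>j\<close> to the front of its list.
  Restricting the schemes to types at most 2 loses nothing for such arguments: S4, S5 and S8
  only ever add arguments of type 0, so all subcomputations stay within these types.
  In S8 the functional is applied only when the inner computation is defined for every \<open>x\<close>.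
\<close>

inductive kleene :: "nat \<Rightarrow> nat list \<Rightarrow> baire list \<Rightarrow> type2 list \<Rightarrow> nat \<Rightarrow> bool" where
  S1: "kleene (list_encode [1]) (a # ns) fs Fs (Suc a)"
| S2: "kleene (list_encode [2, q]) ns fs Fs q"
| S3: "kleene (list_encode [3]) (a # ns) fs Fs a"
| S4: "\<lbrakk>kleene d ns fs Fs u; kleene c (u # ns) fs Fs v\<rbrakk>
       \<Longrightarrow> kleene (list_encode [4, c, d]) ns fs Fs v"
| S5_0: "kleene c ns fs Fs v
       \<Longrightarrow> kleene (list_encode [5, c, d]) (0 # ns) fs Fs v"
| S5_Suc: "\<lbrakk>kleene (list_encode [5, c, d]) (a # ns) fs Fs u; kleene d (a # u # ns) fs Fs v\<rbrakk>
       \<Longrightarrow> kleene (list_encode [5, c, d]) (Suc a # ns) fs Fs v"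
| S6_0: "\<lbrakk>k < length ns; kleene d (ns ! k # take k ns @ drop (Suc k) ns) fs Fs v\<rbrakk>
       \<Longrightarrow> kleene (list_encode [6, 0, k, d]) ns fs Fs v"
| S6_1: "\<lbrakk>k < length fs; kleene d ns (fs ! k # take k fs @ drop (Suc k) fs) Fs v\<rbrakk>
       \<Longrightarrow> kleene (list_encode [6, 1, k, d]) ns fs Fs v"
| S6_2: "\<lbrakk>k < length Fs; kleene d ns fs (Fs ! k # take k Fs @ drop (Suc k) Fs) v\<rbrakk>
       \<Longrightarrow> kleene (list_encode [6, 2, k, d]) ns fs Fs v"
| S7: "kleene (list_encode [7]) (a # ns) (f # fs) Fs (f a)"
| S8: "(\<And>x. kleene d (x # ns) fs (F # Fs) (h x))
       \<Longrightarrow> kleene (list_encode [8, d]) ns fs (F # Fs) (F h)"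
| S9: "\<lbrakk>p \<le> length ns; q \<le> length fs; r \<le> length Fs;
        kleene e (take p ns) (take q fs) (take r Fs) v\<rbrakk>
       \<Longrightarrow> kleene (list_encode [9, p, q, r]) (e # ns) fs Fs v"

lemma kleene_deterministic:
  assumes "kleene e ns fs Fs v" and "kleene e ns fs Fs w"
  shows "v = w"
proof -
  note [simp] = list_encode_eq and [simp del] = list_encode.simps
  note IC = kleene.cases
  from assms show ?thesis
  proof (induction arbitrary: w rule: kleene.induct)
    case S1 from S1.prems show ?case by (rule IC) simp_all
  next
    case S2 from S2.prems show ?case by (rule IC) simp_all
  next
    case S3 from S3.prems show ?case by (rule IC) simp_all
  next
    case S4 from S4.prems show ?case by (rule IC) (simp_all, metis S4.IH)
  next
    case S5_0 from S5_0.prems show ?case by (rule IC) (simp_all add: S5_0.IH)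
  next
    case S5_Suc from S5_Suc.prems show ?case by (rule IC) (simp_all, metis S5_Suc.IH)
  next
    case S6_0 from S6_0.prems show ?case by (rule IC) (simp_all add: S6_0.IH)
  next
    case S6_1 from S6_1.prems show ?case by (rule IC) (simp_all add: S6_1.IH)
  next
    case S6_2 from S6_2.prems show ?case by (rule IC) (simp_all add: S6_2.IH)
  next
    case S7 from S7.prems show ?case by (rule IC) simp_all
  next
    case (S8 d ns fs F Fs h)
    from S8.prems obtain h' where w: "w = F h'" and h': "\<And>x. kleene d (x # ns) fs (F # Fs) (h' x)"
      by (rule IC) simp_all
    have "h = h'" using S8.IH h' by blast
    with w show ?case by simp
  next
    case S9 from S9.prems show ?case by (rule IC) (simp_all add: S9.IH)
  qed
qed

section \<open>Weak fan functionals\<close>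

text \<open>The coin-toss measure; its space is \<open>{0,1}\<^sup>\<nat>\<close>, a subset of the Baire space.\<close>

definition coin_measure :: "baire measure" where
  "coin_measure = (\<Pi>\<^sub>M n\<in>(UNIV :: nat set). uniform_count_measure {0, 1 :: nat})"

definition init_seg :: "baire \<Rightarrow> nat \<Rightarrow> nat list" where
  "init_seg f N = map f [0..<N]"

definition cylinder :: "nat list \<Rightarrow> baire set" where
  "cylinder \<sigma> = {f. (\<forall>n. f n \<in> {0, 1}) \<and> (\<forall>i < length \<sigma>. f i = \<sigma> ! i)}"

definition WFF :: "(type2 \<Rightarrow> nat \<Rightarrow> baire list) \<Rightarrow> bool" where
  "WFF \<Lambda> \<longleftrightarrow> (\<forall>G k.
     measure coin_measure (\<Union>g\<in>set (\<Lambda> G k). cylinder (init_seg g (G g))) \<ge> 1 - 1 / 2 ^ k)"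

text \<open>
  Number-valued coding of a functional with values in finite sequences of functions: component
  \<open>0\<close> is the length of the sequence, component \<open>Suc i\<close> its \<open>i\<close>-th entry (\<open>0\<close> beyond the length).
\<close>

definition seq_code :: "(type2 \<Rightarrow> nat \<Rightarrow> baire list) \<Rightarrow> type2 \<Rightarrow> nat \<Rightarrow> nat \<Rightarrow> nat \<Rightarrow> nat" where
  "seq_code \<Lambda> G k c n = (case c of
     0 \<Rightarrow> length (\<Lambda> G k)
   | Suc i \<Rightarrow> if i < length (\<Lambda> G k) then (\<Lambda> G k ! i) n else 0)"

definition computable_in :: "type2 \<Rightarrow> (type2 \<Rightarrow> nat \<Rightarrow> baire list) \<Rightarrow> bool" where
  "computable_in \<phi> \<Lambda> \<longleftrightarrow>
     (\<exists>e. \<forall>G k c n. kleene e [k, c, n] [] [G, \<phi>] (seq_code \<Lambda> G k c n))"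

definition exists2 :: type2 where
  "exists2 f = (if \<exists>n. f n = 0 then 0 else 1)"

end

(* Fix \<phi>.  A computation whose functional arguments are G and \<phi> applies G only to functions
   x \<mapsto> {d}(x, ns) given by some number d, list ns of numbers and arrangement of the functional
   arguments; there are countably many such data.  By Zorn's lemma there is a maximal partial
   functional R with the property that R(f) always codes data which compute f relative to R itself
   and \<phi>.  By maximality R is defined on every function computable from R and \<phi>, so replacing R by
   a total extension G changes no computation.  Hence every g in \<Lambda>(G, k) has R(g) defined, and as R
   is injective with values at least 2, the cylinders of length G(g) cover measure at most 1/2. *)

theory Submission
  imports Defs
begin

section \<open>Computations relative to partial functionals\<close>

text \<open>
  Kleene's schemes without arguments of type 1, where the arguments of type 2 are names \<open>t\<close> of
  partial functionals with graph \<open>I t\<close>.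
\<close>

inductive pkleene :: "('t \<Rightarrow> (baire \<times> nat) set) \<Rightarrow> nat \<Rightarrow> nat list \<Rightarrow> 't list \<Rightarrow> nat \<Rightarrow> bool"
  for I where
  P1: "pkleene I (list_encode [1]) (a # ns) ts (Suc a)"
| P2: "pkleene I (list_encode [2, q]) ns ts q"
| P3: "pkleene I (list_encode [3]) (a # ns) ts a"
| P4: "\<lbrakk>pkleene I d ns ts u; pkleene I c (u # ns) ts v\<rbrakk>
       \<Longrightarrow> pkleene I (list_encode [4, c, d]) ns ts v"
| P5_0: "pkleene I c ns ts v \<Longrightarrow> pkleene I (list_encode [5, c, d]) (0 # ns) ts v"
| P5_Suc: "\<lbrakk>pkleene I (list_encode [5, c, d]) (a # ns) ts u; pkleene I d (a # u # ns) ts v\<rbrakk>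
       \<Longrightarrow> pkleene I (list_encode [5, c, d]) (Suc a # ns) ts v"
| P6_0: "\<lbrakk>k < length ns; pkleene I d (ns ! k # take k ns @ drop (Suc k) ns) ts v\<rbrakk>
       \<Longrightarrow> pkleene I (list_encode [6, 0, k, d]) ns ts v"
| P6_2: "\<lbrakk>k < length ts; pkleene I d ns (ts ! k # take k ts @ drop (Suc k) ts) v\<rbrakk>
       \<Longrightarrow> pkleene I (list_encode [6, 2, k, d]) ns ts v"
| P8: "\<lbrakk>\<And>x. pkleene I d (x # ns) (t # ts) (h x); (h, v) \<in> I t\<rbrakk>
       \<Longrightarrow> pkleene I (list_encode [8, d]) ns (t # ts) v"
| P9: "\<lbrakk>p \<le> length ns; r \<le> length ts; pkleene I e (take p ns) (take r ts) v\<rbrakk>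
       \<Longrightarrow> pkleene I (list_encode [9, p, 0, r]) (e # ns) ts v"

text \<open>The graphs occur only positively, as the lookup in \<open>P8\<close>, so a computation
  survives when they grow.\<close>

lemma pkleene_mono:
  assumes "pkleene I e ns ts v" and "\<And>t. I t \<subseteq> J t"
  shows "pkleene J e ns ts v"
  using assms(1)
proof induction
  case (P8 d ns t ts h v)
  then show ?case using assms(2) by (blast intro: pkleene.P8)
qed (auto intro: pkleene.intros simp del: list_encode.simps One_nat_def)

lemma kleene_if_pkleene:
  assumes "pkleene I e ns ts v" and ext: "\<And>t f w. (f, w) \<in> I t \<Longrightarrow> J t f = w"
  shows "kleene e ns [] (map J ts) v"
  using assms(1)
proof induction
  case (P6_2 k ts d ns v)
  then show ?case
    by (intro kleene.S6_2) (simp_all add: take_map drop_map)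
next
  case (P8 d ns t ts h v)
  then have "kleene (list_encode [8, d]) ns [] (J t # map J ts) (J t h)"
    by (intro kleene.S8) simp
  then show ?case using ext[OF P8.hyps(2)] by simp
next
  case (P9 p ns r ts e v)
  then show ?case by (intro kleene.S9) (simp_all add: take_map)
qed (auto intro: kleene.intros simp del: list_encode.simps One_nat_def)

text \<open>The only functions that \<open>S8\<close> submits to \<open>J t\<close> are those
  covered by \<open>closed\<close>, so a computation from the total functionals never leaves the
  graphs.\<close>

lemma pkleene_if_kleene:
  assumes "kleene e ns [] (map J ts) v"
    and closed: "\<And>d ns t ts h. (\<And>x. pkleene I d (x # ns) (t # ts) (h x)) \<Longrightarrow> (h, J t h) \<in> I t"
  shows "pkleene I e ns ts v"
proof -
  \<comment> \<open>As \<open>fs\<close> is empty, \<open>S6_1\<close> and \<open>S7\<close> cannot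
    occur and \<open>S9\<close> has \<open>q = 0\<close>.\<close>
  have "pkleene I e ns ts v"
    if "kleene e ns fs Fs v" "fs = []" "Fs = map J ts" for fs Fs
    using that
  proof (induction arbitrary: ts)
    case (S6_2 k Fs d ns fs v)
    then show ?case
      by (intro pkleene.P6_2) (simp_all add: take_map drop_map)
  next
    case (S8 d ns fs F Fs h)
    then obtain t ts' where ts: "ts = t # ts'" "F = J t" "Fs = map J ts'" by auto
    with S8 have "\<And>x. pkleene I d (x # ns) (t # ts') (h x)" by simp
    with closed[OF this] show ?case unfolding ts by (blast intro: pkleene.P8)
  next
    case (S9 p ns q fs r Fs e v)
    then show ?case by (auto intro!: pkleene.P9 simp: take_map simp del: list_encode.simps)
  qed (auto intro: pkleene.intros simp del: list_encode.simps One_nat_def)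
  with assms(1) show ?thesis by blast
qed

section \<open>A self-indexing partial functional\<close>

text \<open>Booleans serve as names so that an arrangement of functional arguments is a list in a
  countable type.\<close>

definition interp :: "type2 \<Rightarrow> (baire \<times> nat) set \<Rightarrow> bool \<Rightarrow> (baire \<times> nat) set" where
  "interp \<phi> R b = (if b then R else range (\<lambda>f. (f, \<phi> f)))"

fun computes :: "type2 \<Rightarrow> (baire \<times> nat) set \<Rightarrow> nat \<times> nat list \<times> bool list \<Rightarrow> baire \<Rightarrow> bool" where
  "computes \<phi> R (d, ns, bs) f \<longleftrightarrow> (\<forall>x. pkleene (interp \<phi> R) d (x # ns) bs (f x))"

text \<open>The computation behind a value of \<open>R\<close> may query \<open>R\<close> itself.
  This circularity is harmless, since \<open>computes\<close> is preserved when \<open>R\<close>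
  grows.\<close>

definition self_indexing ::
    "(nat \<times> nat list \<times> bool list \<Rightarrow> nat) \<Rightarrow> type2 \<Rightarrow> (baire \<times> nat) set \<Rightarrow> bool" where
  "self_indexing code \<phi> R \<longleftrightarrow>
     single_valued R \<and> (\<forall>(f, m) \<in> R. \<exists>i. m = code i \<and> computes \<phi> R i f)"

lemma computes_mono:
  assumes "computes \<phi> R i f" and "R \<subseteq> S"
  shows "computes \<phi> S i f"
proof -
  have "interp \<phi> R b \<subseteq> interp \<phi> S b" for b
    using assms(2) by (simp add: interp_def)
  with assms(1) show ?thesis by (cases i) (auto intro: pkleene_mono)
qed

lemma kleene_if_pkleene_interp:
  assumes "pkleene (interp \<phi> R) e ns bs v" and "\<And>f m. (f, m) \<in> R \<Longrightarrow> G f = m"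
  shows "kleene e ns [] (map (\<lambda>b. if b then G else \<phi>) bs) v"
  using assms(1) by (rule kleene_if_pkleene) (auto simp: interp_def assms(2) split: if_splits)

lemma single_valued_extension:
  assumes "single_valued R"
  obtains G where "\<And>f m. (f, m) \<in> R \<Longrightarrow> G f = m"
proof
  \<comment> \<open>Outside the domain of \<open>R\<close> the value of the extension is
    arbitrary.\<close>
  show "(THE m. (f, m) \<in> R) = m" if "(f, m) \<in> R" for f m
    using that assms by (auto dest: single_valuedD)
qed

text \<open>The value determines the index, and the index determines the function it computes.
  Passing to a total extension \<open>G\<close> makes determinism of \<open>kleene\<close>
  available.\<close>

lemma self_indexing_inj:
  assumes "self_indexing code \<phi> R" and "inj code" and "(f, m) \<in> R" and "(g, m) \<in> R"
  shows "f = g"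
proof
  fix x
  obtain G where G: "\<And>f m. (f, m) \<in> R \<Longrightarrow> G f = m"
    using assms(1) single_valued_extension unfolding self_indexing_def by blast
  obtain i j where "m = code i" "computes \<phi> R i f" "m = code j" "computes \<phi> R j g"
    using assms unfolding self_indexing_def by blast
  moreover from this have "i = j" using \<open>inj code\<close> by (simp add: inj_eq)
  moreover obtain d ns bs where "j = (d, ns, bs)" by (cases j)
  ultimately have "pkleene (interp \<phi> R) d (x # ns) bs (f x)"
      and "pkleene (interp \<phi> R) d (x # ns) bs (g x)"
    by simp_all
  then show "f x = g x"
    by (blast intro: kleene_deterministic kleene_if_pkleene_interp[where G = G and R = R] G)
qed

lemma self_indexing_Union:
  assumes chain: "\<And>R S. R \<in> C \<Longrightarrow> S \<in> C \<Longrightarrow> R \<subseteq> S \<or> S \<subseteq> R"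
    and C: "\<And>R. R \<in> C \<Longrightarrow> self_indexing code \<phi> R"
  shows "self_indexing code \<phi> (\<Union>C)"
  unfolding self_indexing_def
proof
  show "single_valued (\<Union>C)"
  proof (rule single_valuedI)
    fix f m n assume "(f, m) \<in> \<Union>C" "(f, n) \<in> \<Union>C"
    then obtain R S where RS: "R \<in> C" "(f, m) \<in> R" "S \<in> C" "(f, n) \<in> S" by blast
    with chain obtain T where "T \<in> C" "(f, m) \<in> T" "(f, n) \<in> T" by blast
    with C show "m = n" unfolding self_indexing_def by (blast dest: single_valuedD)
  qed
  show "\<forall>(f, m) \<in> \<Union>C. \<exists>i. m = code i \<and> computes \<phi> (\<Union>C) i f"
  proof clarify
    fix f m R assume R: "(f, m) \<in> R" "R \<in> C"
    with C obtain i where "m = code i" "computes \<phi> R i f"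
      unfolding self_indexing_def by blast
    with R show "\<exists>i. m = code i \<and> computes \<phi> (\<Union>C) i f"
      by (blast intro: computes_mono)
  qed
qed

lemma closed_self_indexing_exists:
  obtains R where "self_indexing code \<phi> R" and "\<And>i f. computes \<phi> R i f \<Longrightarrow> f \<in> Domain R"
proof -
  have "\<exists>R \<in> Collect (self_indexing code \<phi>). \<forall>S \<in> Collect (self_indexing code \<phi>). R \<subseteq> S \<longrightarrow> S = R"
  proof (rule subset_Zorn')
    fix C assume "subset.chain (Collect (self_indexing code \<phi>)) C"
    then show "\<Union>C \<in> Collect (self_indexing code \<phi>)"
      by (auto simp: subset_chain_def intro!: self_indexing_Union)
  qed
  then obtain R where R: "self_indexing code \<phi> R"
    and maximal: "\<And>S. self_indexing code \<phi> S \<Longrightarrow> R \<subseteq> S \<Longrightarrow> S = R"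
    by blast
  have "f \<in> Domain R" if f: "computes \<phi> R i f" for i f
  proof (rule ccontr)
    assume new: "f \<notin> Domain R"
    \<comment> \<open>The new function receives its own index as value; by monotonicity all indices,
      old and new, still compute their functions from \<open>?S\<close>.\<close>
    let ?S = "insert (f, code i) R"
    have "single_valued ?S"
      using R new unfolding self_indexing_def single_valued_def by blast
    moreover have "\<exists>j. m = code j \<and> computes \<phi> ?S j g" if "(g, m) \<in> ?S" for g m
    proof -
      from that R f have "\<exists>j. m = code j \<and> computes \<phi> R j g"
        unfolding self_indexing_def by blast
      then show ?thesis by (blast intro: computes_mono)
    qed
    ultimately have "self_indexing code \<phi> ?S"
      unfolding self_indexing_def by blast
    with maximal have "?S = R" by blast
    with new show False by blast
  qed
  with R that show thesis by blast
qed

section \<open>Measure of cylinders\<close>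

lemma coin_factor: "prob_space (uniform_count_measure {0, 1 :: nat})"
  by (rule prob_space_uniform_count_measure) auto

interpretation coin: product_prob_space "\<lambda>_. uniform_count_measure {0, 1 :: nat}" UNIV
  by (intro product_prob_spaceI coin_factor)

text \<open>The sequence need not be binary: an entry other than 0 and 1 gives an empty factor and
  an empty cylinder, which is why the measure is only bounded above below.\<close>

lemma cylinder_eq_prod_emb:
  "cylinder \<sigma> = prod_emb UNIV (\<lambda>_. uniform_count_measure {0, 1 :: nat}) {..<length \<sigma>}
     (\<Pi>\<^sub>E i\<in>{..<length \<sigma>}. {\<sigma> ! i} \<inter> {0, 1})"
  unfolding cylinder_def prod_emb_def
  by (auto simp: space_uniform_count_measure PiE_def Pi_def restrict_def extensional_def)

lemma cylinder_sets: "cylinder \<sigma> \<in> sets coin_measure"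
  unfolding cylinder_eq_prod_emb coin_measure_def
  by (rule sets_PiM_I) (auto simp: sets_uniform_count_measure)

lemma measure_cylinder_le: "measure coin_measure (cylinder \<sigma>) \<le> (1/2) ^ length \<sigma>"
proof -
  have "measure coin_measure (cylinder \<sigma>) =
      (\<Prod>i<length \<sigma>. measure (uniform_count_measure {0, 1 :: nat}) ({\<sigma> ! i} \<inter> {0, 1}))"
    unfolding cylinder_eq_prod_emb coin_measure_def
    by (rule coin.measure_PiM_emb) (auto simp: sets_uniform_count_measure)
  also have "\<dots> \<le> (\<Prod>i<length \<sigma>. 1/2)"
  proof (intro prod_mono conjI)
    show "measure (uniform_count_measure {0, 1 :: nat}) ({\<sigma> ! i} \<inter> {0, 1}) \<le> 1/2" for i
      using card_mono[of "{\<sigma> ! i}" "{\<sigma> ! i} \<inter> {0, 1}"]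
      by (simp add: measure_uniform_count_measure)
  qed simp
  finally show ?thesis by simp
qed

lemma measure_UN_cylinder_le:
  assumes "finite A"
  shows "measure coin_measure (\<Union>g\<in>A. cylinder (init_seg g (G g))) \<le> (\<Sum>g\<in>A. (1/2) ^ G g)"
proof -
  have "measure coin_measure (\<Union>g\<in>A. cylinder (init_seg g (G g)))
      \<le> (\<Sum>g\<in>A. measure coin_measure (cylinder (init_seg g (G g))))"
    using assms cylinder_sets unfolding coin_measure_def
    by (intro coin.finite_measure_subadditive_finite) auto
  also have "\<dots> \<le> (\<Sum>g\<in>A. (1/2) ^ G g)"
    using measure_cylinder_le[of "init_seg _ _"] by (intro sum_mono) (simp add: init_seg_def)
  finally show ?thesis .
qed

lemma sum_half_powers_le:
  assumes "finite N" and "\<And>n. n \<in> N \<Longrightarrow> 2 \<le> n"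
  shows "(\<Sum>n\<in>N. (1/2::real) ^ n) \<le> 1/2"
proof -
  obtain K where K: "N \<subseteq> {2..<K}"
    using assms finite_nat_set_iff_bounded[of N] by fastforce
  have "(\<Sum>n\<in>{2..<K}. (1/2::real) ^ n) \<le> 1/2"
  proof (cases "2 \<le> K")
    case True
    \<comment> \<open>Partial sum of the geometric series; the full tail from 2 on is 1/2.\<close>
    then have "(\<Sum>n\<in>{2..<K}. (1/2::real) ^ n) = 1/2 - 2 * (1/2) ^ K"
      by (induction K rule: dec_induct) (auto simp: power2_eq_square)
    then show ?thesis by simp
  qed simp
  moreover have "(\<Sum>n\<in>N. (1/2::real) ^ n) \<le> (\<Sum>n\<in>{2..<K}. (1/2) ^ n)"
    using K by (intro sum_mono2) auto
  ultimately show ?thesis by linarith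
qed

section \<open>Weak fan functionals\<close>

text \<open>In \<open>computes\<close> the varying argument comes first, while \<open>e\<close>
  expects it last. S6 only moves to the front, so three moves are made: \<open>[n, k, c]\<close>,
  \<open>[k, n, c]\<close>, \<open>[c, k, n]\<close>, \<open>[k, c, n]\<close>.\<close>

lemma kleene_rotate3:
  assumes "kleene e [k, c, n] fs Fs v"
  shows "kleene (list_encode [6, 0, 1, list_encode [6, 0, 2, list_encode [6, 0, 1, e]]])
    [n, k, c] fs Fs v"
  using assms by (auto intro!: kleene.S6_0 simp: numeral_2_eq_2 simp del: list_encode.simps)

lemma not_computable_WFF:
  assumes "WFF \<Lambda>"
  shows "\<not> computable_in \<phi> \<Lambda>"
proof
  assume "computable_in \<phi> \<Lambda>"
  then obtain e where e: "\<And>G k c n. kleene e [k, c, n] [] [G, \<phi>] (seq_code \<Lambda> G k c n)"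
    unfolding computable_in_def by blast
  \<comment> \<open>The shift by 2 keeps the sum of \<open>(1/2) ^ G g\<close> over distinct values
    at most 1/2.\<close>
  define code :: "nat \<times> nat list \<times> bool list \<Rightarrow> nat" where "code i = to_nat i + 2" for i
  have inj: "inj code" by (auto simp: code_def inj_def)
  obtain R where R: "self_indexing code \<phi> R"
    and closed: "\<And>i f. computes \<phi> R i f \<Longrightarrow> f \<in> Domain R"
    using closed_self_indexing_exists by blast
  obtain G where G: "\<And>f m. (f, m) \<in> R \<Longrightarrow> G f = m"
    using R single_valued_extension unfolding self_indexing_def by blast
  have G_R: "(f, G f) \<in> R" if "f \<in> Domain R" for f
    using that G by blast
  \<comment> \<open>Closure of \<open>R\<close> makes \<open>G\<close> and \<open>R\<close>
    interchangeable in computations.\<close>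
  have pkleene: "pkleene (interp \<phi> R) d ns bs v"
    if "kleene d ns [] (map (\<lambda>b. if b then G else \<phi>) bs) v" for d ns bs v
    using that
  proof (rule pkleene_if_kleene)
    fix d ns t ts h
    assume "\<And>x. pkleene (interp \<phi> R) d (x # ns) (t # ts) (h x)"
    then have "h \<in> Domain R" by (intro closed[of "(d, ns, t # ts)"]) simp
    then show "(h, (if t then G else \<phi>) h) \<in> interp \<phi> R t"
      by (simp add: interp_def G_R)
  qed
  \<comment> \<open>For \<open>k = 2\<close> a weak fan functional must reach measure 3/4, more than
    1/2.\<close>
  define A where "A = set (\<Lambda> G 2)"
  have A: "g \<in> Domain R" if g: "g \<in> A" for g
  proof -
    obtain i where i: "i < length (\<Lambda> G 2)" "g = \<Lambda> G 2 ! i"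
      using g unfolding A_def by (metis in_set_conv_nth)
    let ?d = "list_encode [6, 0, 1, list_encode [6, 0, 2, list_encode [6, 0, 1, e]]]"
    \<comment> \<open>Component \<open>Suc i\<close> is entry \<open>i\<close>, as component 0 holds
      the length.\<close>
    have "kleene ?d [n, 2, Suc i] [] (map (\<lambda>b. if b then G else \<phi>) [True, False]) (g n)" for n
      using kleene_rotate3[OF e[of 2 "Suc i" n G]] i
      by (simp add: seq_code_def del: list_encode.simps)
    then have "computes \<phi> R (?d, [2, Suc i], [True, False]) g"
      by (auto intro: pkleene simp del: list_encode.simps)
    then show ?thesis by (rule closed)
  qed
  have "inj_on G A"
  proof (rule inj_onI)
    fix f g assume "f \<in> A" "g \<in> A" "G f = G g"
    then show "f = g" using self_indexing_inj[OF R inj] G_R A by metis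
  qed
  then have "(\<Sum>g\<in>A. (1/2::real) ^ G g) = (\<Sum>n\<in>G ` A. (1/2) ^ n)"
    by (simp add: sum.reindex)
  also have "\<dots> \<le> 1/2"
  proof (rule sum_half_powers_le)
    show "2 \<le> n" if n: "n \<in> G ` A" for n
    proof -
      obtain g where "g \<in> A" "n = G g" using n by blast
      then have "(g, n) \<in> R" using A G_R by blast
      then show ?thesis using R unfolding self_indexing_def code_def by force
    qed
  qed (simp add: A_def)
  finally have "measure coin_measure (\<Union>g\<in>A. cylinder (init_seg g (G g))) \<le> 1/2"
    using measure_UN_cylinder_le[of A G] by (simp add: A_def)
  moreover have "measure coin_measure (\<Union>g\<in>A. cylinder (init_seg g (G g))) \<ge> 1 - 1 / 2 ^ 2"
    using assms unfolding WFF_def A_def by blast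
  ultimately show False by (simp add: power2_eq_square)
qed

theorem theorem3p13:
  shows "(\<nexists>\<Lambda>. WFF \<Lambda> \<and> computable_in exists2 \<Lambda>) \<and>
         (\<forall>\<phi> :: (nat \<Rightarrow> nat) \<Rightarrow> nat. \<nexists>\<Lambda>. WFF \<Lambda> \<and> computable_in \<phi> \<Lambda>)"
  using not_computable_WFF by blast

end
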